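(* Let $\omega\in\mathbb R\setminus\{0\}$, $f\in\mathsf H_1$, let $(x,y)\in D(A)\times D(A^* )$ be the exact solution of the mixed problem $$A^*y+i\omega\alpha_1x=f,\qquad \alpha_2Ax=y,$$ and let $(\tilde x,\tilde y)\in D(A)\times D(A^* )$ be arbitrary. Then $$\frac{\sqrt2}{\sqrt2+1}\,\mathcal M_i(\tilde x,\tilde y)\le|\!|\!|(x,y)-(\tilde x,\tilde y)|\!|\!|^2\le\frac{\sqrt2}{\sqrt2-1}\,\mathcal M_i(\tilde x,\tilde y),$$ and, if $f\neq0$, also $$\frac{\sqrt2}{2(\sqrt2+1)}\cdot\frac{\mathcal M_i(\tilde x,\tilde y)}{|f|_{\mathsf H_1,(|\omega|\alpha_1)^{-1}}^2}\le\frac{|\!|\!|(x,y)-(\tilde x,\tilde y)|\!|\!|^2}{|\!|\!|(x,y)|\!|\!|^2}\le\frac{\sqrt2}{\sqrt2-1}\cdot\frac{\mathcal M_i(\tilde x,\tilde y)}{|f|_{\mathsf H_1,(|\omega|\alpha_1)^{-1}}^2},$$ where $$\mathcal M_i(\tilde x,\tilde y):=|f-i\omega\alpha_1\tilde x-A^*\tilde y|_{\mathsf H_1,(|\omega|\alpha_1)^{-1}}^2+|\tilde y-\alpha_2A\tilde x|_{\mathsf H_2,\alpha_2^{-1}}^2 .$$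
   Context: $\mathsf H_1,\mathsf H_2$ are complex Hilbert spaces with inner products $\langle\cdot,\cdot\rangle_{\mathsf H_1}$, $\langle\cdot,\cdot\rangle_{\mathsf H_2}$ (linear in the first argument); $i$ is the imaginary unit. $A:D(A)\subset\mathsf H_1\to\mathsf H_2$ is a densely defined, closed linear operator with adjoint $A^*:D(A^* )\subset\mathsf H_2\to\mathsf H_1$. The maps $\alpha_1:\mathsf H_1\to\mathsf H_1$ and $\alpha_2:\mathsf H_2\to\mathsf H_2$ are linear, self-adjoint, positive topological isomorphisms; in particular there is $c>0$ with $c^{-1}|\varphi|^2\le\langle\alpha_j\varphi,\varphi\rangle\le c|\varphi|^2$ for all $\varphi\in\mathsf H_j$, $j=1,2$. Weighted norms: for a self-adjoint positive topological isomorphism $\beta$ of $\mathsf H_j$, $|\varphi|_{\mathsf H_j,\beta}^2:=\langle\beta\varphi,\varphi\rangle_{\mathsf H_j}$. For $(\varphi,\psi)\in D(A)\times D(A^* )$ the combined norm is $$|\!|\!|(\varphi,\psi)|\!|\!|^2:=|\varphi|_{\mathsf H_1,|\omega|\alpha_1}^2+|A\varphi|_{\mathsf H_2,\alpha_2}^2+|\psi|_{\mathsf H_2,\alpha_2^{-1}}^2+|A^*\psi|_{\mathsf H_1,(|\omega|\alpha_1)^{-1}}^2 .$$ The mixed problem has a unique solution $(x,y)\in D(A)\times D(A^* )$ for each $f\in\mathsf H_1$. *)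

theory Defs
  imports "HOL-Analysis.Analysis"
begin

section \<open>Complex Hilbert spaces\<close>

text \<open>HOL-Analysis has only real inner product spaces. Completeness, and the agreement of the
  complex with the real structure, come from extending \<^class>\<open>banach\<close>; the inner product is
  linear in its first argument.\<close>

class complex_hilbert = banach +
  fixes scaleC :: "complex \<Rightarrow> 'a \<Rightarrow> 'a" (infixr "*\<^sub>C" 75)
    and cinner :: "'a \<Rightarrow> 'a \<Rightarrow> complex"
  assumes scaleC_add_right: "c *\<^sub>C (u + v) = c *\<^sub>C u + c *\<^sub>C v"
    and scaleC_add_left: "(c + d) *\<^sub>C u = c *\<^sub>C u + d *\<^sub>C u"
    and scaleC_scaleC: "c *\<^sub>C d *\<^sub>C u = (c * d) *\<^sub>C u"
    and scaleC_of_real: "complex_of_real r *\<^sub>C u = r *\<^sub>R u"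
    and cinner_commute: "cinner u v = cnj (cinner v u)"
    and cinner_add_left: "cinner (u + v) w = cinner u w + cinner v w"
    and cinner_scaleC_left: "cinner (c *\<^sub>C u) v = c * cinner u v"
    and cinner_ge_zero: "0 \<le> Re (cinner u u)"
    and cinner_eq_zero_iff: "cinner u u = 0 \<longleftrightarrow> u = 0"
    and norm_eq_sqrt_cinner: "norm u = sqrt (Re (cinner u u))"

lemma scaleC_one: "1 *\<^sub>C u = (u :: 'a :: complex_hilbert)"
  using scaleC_of_real[of 1 u] by simp

global_interpretation complex_hilbert: vector_space
  "scaleC :: complex \<Rightarrow> 'a \<Rightarrow> 'a :: complex_hilbert"
  by unfold_locales (simp_all add: scaleC_add_right scaleC_add_left scaleC_scaleC scaleC_one)

instantiation complex :: complex_hilbert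
begin

definition scaleC_complex :: "complex \<Rightarrow> complex \<Rightarrow> complex" where
  "scaleC_complex c u = c * u"

definition cinner_complex :: "complex \<Rightarrow> complex \<Rightarrow> complex" where
  "cinner_complex u v = u * cnj v"

instance
  by standard
    (simp_all add: scaleC_complex_def cinner_complex_def algebra_simps scaleR_conv_of_real
      cmod_def power2_eq_square)

end


section \<open>Unbounded operators\<close>

text \<open>An unbounded operator is a pair of a domain \<open>D\<close> and a function \<open>A\<close> whose values outside
  \<open>D\<close> are irrelevant.\<close>

definition linear_operator ::
    "'a :: complex_hilbert set \<Rightarrow> ('a \<Rightarrow> 'b :: complex_hilbert) \<Rightarrow> bool" where
  "linear_operator D A \<longleftrightarrow> complex_hilbert.subspace D \<and>
     (\<forall>u\<in>D. \<forall>v\<in>D. A (u + v) = A u + A v) \<and>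
     (\<forall>c. \<forall>u\<in>D. A (c *\<^sub>C u) = c *\<^sub>C A u)"

definition densely_defined :: "'a :: complex_hilbert set \<Rightarrow> bool" where
  "densely_defined D \<longleftrightarrow> closure D = UNIV"

definition closed_operator ::
    "'a :: complex_hilbert set \<Rightarrow> ('a \<Rightarrow> 'b :: complex_hilbert) \<Rightarrow> bool" where
  "closed_operator D A \<longleftrightarrow> closed ((\<lambda>u. (u, A u)) ` D)"

definition adj_dom ::
    "'a :: complex_hilbert set \<Rightarrow> ('a \<Rightarrow> 'b :: complex_hilbert) \<Rightarrow> 'b set" where
  "adj_dom D A = {\<psi>. \<exists>\<eta>. \<forall>\<phi>\<in>D. cinner (A \<phi>) \<psi> = cinner \<phi> \<eta>}"

text \<open>For \<open>\<psi>\<close> in \<open>adj_dom D A\<close> the vector below is unique because \<open>D\<close> is dense.\<close>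

definition adj ::
    "'a :: complex_hilbert set \<Rightarrow> ('a \<Rightarrow> 'b :: complex_hilbert) \<Rightarrow> 'b \<Rightarrow> 'a" where
  "adj D A \<psi> = (THE \<eta>. \<forall>\<phi>\<in>D. cinner (A \<phi>) \<psi> = cinner \<phi> \<eta>)"


section \<open>Weights\<close>

definition selfadjoint :: "('a :: complex_hilbert \<Rightarrow> 'a) \<Rightarrow> bool" where
  "selfadjoint \<beta> \<longleftrightarrow> (\<forall>u v. cinner (\<beta> u) v = cinner u (\<beta> v))"

definition positive_operator :: "('a :: complex_hilbert \<Rightarrow> 'a) \<Rightarrow> bool" where
  "positive_operator \<beta> \<longleftrightarrow> (\<forall>u. Im (cinner (\<beta> u) u) = 0 \<and> 0 \<le> Re (cinner (\<beta> u) u))"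

text \<open>The two-sided estimate \<open>\<bar>u\<bar>\<^sup>2 / c \<le> \<langle>\<beta> u, u\<rangle> \<le> c \<bar>u\<bar>\<^sup>2\<close> is a consequence of the
  following definition, see \<open>weight_coercive\<close> below.\<close>

definition weight :: "('a :: complex_hilbert \<Rightarrow> 'a) \<Rightarrow> bool" where
  "weight \<beta> \<longleftrightarrow> Vector_Spaces.linear scaleC scaleC \<beta> \<and> selfadjoint \<beta> \<and> positive_operator \<beta> \<and>
     homeomorphism UNIV UNIV \<beta> (inv \<beta>)"

definition wnorm :: "('a :: complex_hilbert \<Rightarrow> 'a) \<Rightarrow> 'a \<Rightarrow> real" where
  "wnorm \<beta> u = sqrt (Re (cinner (\<beta> u) u))"


section \<open>The mixed problem\<close>

definition mixed_solution ::
    "'a :: complex_hilbert set \<Rightarrow> ('a \<Rightarrow> 'b :: complex_hilbert) \<Rightarrow> ('a \<Rightarrow> 'a) \<Rightarrow> ('b \<Rightarrow> 'b) \<Rightarrow>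
      real \<Rightarrow> 'a \<Rightarrow> 'a \<Rightarrow> 'b \<Rightarrow> bool" where
  "mixed_solution D A \<alpha>1 \<alpha>2 \<omega> f x y \<longleftrightarrow> x \<in> D \<and> y \<in> adj_dom D A \<and>
     adj D A y + (\<i> * complex_of_real \<omega>) *\<^sub>C \<alpha>1 x = f \<and> \<alpha>2 (A x) = y"

definition combined_norm ::
    "'a :: complex_hilbert set \<Rightarrow> ('a \<Rightarrow> 'b :: complex_hilbert) \<Rightarrow> ('a \<Rightarrow> 'a) \<Rightarrow> ('b \<Rightarrow> 'b) \<Rightarrow>
      real \<Rightarrow> 'a \<Rightarrow> 'b \<Rightarrow> real" where
  "combined_norm D A \<alpha>1 \<alpha>2 \<omega> \<phi> \<psi> =
     sqrt ((wnorm (\<lambda>u. \<bar>\<omega>\<bar> *\<^sub>R \<alpha>1 u) \<phi>)\<^sup>2 + (wnorm \<alpha>2 (A \<phi>))\<^sup>2 +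
           (wnorm (inv \<alpha>2) \<psi>)\<^sup>2 + (wnorm (inv (\<lambda>u. \<bar>\<omega>\<bar> *\<^sub>R \<alpha>1 u)) (adj D A \<psi>))\<^sup>2)"

definition mixed_majorant ::
    "'a :: complex_hilbert set \<Rightarrow> ('a \<Rightarrow> 'b :: complex_hilbert) \<Rightarrow> ('a \<Rightarrow> 'a) \<Rightarrow> ('b \<Rightarrow> 'b) \<Rightarrow>
      real \<Rightarrow> 'a \<Rightarrow> 'a \<Rightarrow> 'b \<Rightarrow> real" where
  "mixed_majorant D A \<alpha>1 \<alpha>2 \<omega> f x' y' =
     (wnorm (inv (\<lambda>u. \<bar>\<omega>\<bar> *\<^sub>R \<alpha>1 u))
        (f - (\<i> * complex_of_real \<omega>) *\<^sub>C \<alpha>1 x' - adj D A y'))\<^sup>2 +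
     (wnorm (inv \<alpha>2) (y' - \<alpha>2 (A x')))\<^sup>2"


section \<open>Well-definedness of the adjoint, coercivity of the weights\<close>

lemma cinner_add_right: "cinner u (v + w) = cinner u v + cinner u (w :: 'a :: complex_hilbert)"
  by (metis cinner_add_left cinner_commute complex_cnj_add)

lemma cinner_scaleC_right: "cinner u (c *\<^sub>C v) = cnj c * cinner u (v :: 'a :: complex_hilbert)"
  by (metis cinner_commute cinner_scaleC_left complex_cnj_mult)

lemma Re_cinner_self: "Re (cinner u u) = (norm (u :: 'a :: complex_hilbert))\<^sup>2"
  by (simp add: norm_eq_sqrt_cinner cinner_ge_zero)

lemma Im_cinner_self: "Im (cinner u (u :: 'a :: complex_hilbert)) = 0"
  using arg_cong[OF cinner_commute[of u u], of Im] by simp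

lemma cinner_diff_right: "cinner u (v - w) = cinner u v - cinner u (w :: 'a :: complex_hilbert)"
  using cinner_add_right[of u "v - w" w] by simp

lemma adj_eqI:
  assumes "densely_defined D" "\<forall>\<phi>\<in>D. cinner (A \<phi>) \<psi> = cinner \<phi> \<eta>"
  shows "adj D A \<psi> = (\<eta> :: 'a :: complex_hilbert)"
  unfolding adj_def
proof (rule the_equality[where P = "\<lambda>\<eta>. \<forall>\<phi>\<in>D. cinner (A \<phi>) \<psi> = cinner \<phi> \<eta>", OF assms(2)])
  fix \<zeta> assume z: "\<forall>\<phi>\<in>D. cinner (A \<phi>) \<psi> = cinner \<phi> \<zeta>"
  define w where "w = \<zeta> - \<eta>"
  have orth: "cinner \<phi> w = 0" if "\<phi> \<in> D" for \<phi>
    using z assms(2) that by (simp add: w_def cinner_diff_right)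
  show "\<zeta> = \<eta>"
  proof (rule ccontr)
    assume "\<zeta> \<noteq> \<eta>"
    then have pos: "norm w > 0" by (simp add: w_def)
    have "w \<in> closure D" using assms(1) by (simp add: densely_defined_def)
    then obtain \<phi> where p: "\<phi> \<in> D" "dist \<phi> w < norm w"
      using pos closure_approachable by blast
    have "(norm (\<phi> - w))\<^sup>2 = (norm \<phi>)\<^sup>2 + (norm w)\<^sup>2"
    proof -
      have a: "cinner w \<phi> = 0" using orth[OF p(1)] cinner_commute[of w \<phi>] by simp
      have b: "cinner (\<phi> - w) v = cinner \<phi> v - cinner w v" for v
        using cinner_add_left[of "\<phi> - w" w v] by simp
      show ?thesis
        using orth[OF p(1)] a by (simp add: Re_cinner_self[symmetric] b cinner_diff_right)
    qed
    then have "norm w \<le> norm (\<phi> - w)"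
      by (metis le_add_same_cancel2 norm_ge_zero power2_le_imp_le zero_le_power2)
    with p(2) show False by (simp add: dist_norm)
  qed
qed

lemma positive_cauchy_schwarz:
  fixes \<beta> :: "'a :: complex_hilbert \<Rightarrow> 'a"
  assumes lin: "Vector_Spaces.linear scaleC scaleC \<beta>" and "selfadjoint \<beta>" "positive_operator \<beta>"
  shows "(Re (cinner (\<beta> u) v))\<^sup>2 \<le> Re (cinner (\<beta> u) u) * Re (cinner (\<beta> v) v)"
proof -
  interpret l: Vector_Spaces.linear scaleC scaleC \<beta> by fact
  let ?a = "Re (cinner (\<beta> u) u)" and ?b = "Re (cinner (\<beta> u) v)" and ?c = "Re (cinner (\<beta> v) v)"
  have sym: "Re (cinner (\<beta> v) u) = ?b"
    using assms(2) unfolding selfadjoint_def by (metis cinner_commute complex_cnj cnj.sel(1))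
  have quad: "0 \<le> ?a + 2 * t * ?b + t\<^sup>2 * ?c" for t :: real
  proof -
    have "0 \<le> Re (cinner (\<beta> (u + of_real t *\<^sub>C v)) (u + of_real t *\<^sub>C v))"
      using assms(3) by (simp add: positive_operator_def)
    also have "\<dots> = ?a + 2 * t * ?b + t\<^sup>2 * ?c"
      by (simp add: l.add l.scale cinner_add_left cinner_add_right cinner_scaleC_left
          cinner_scaleC_right sym power2_eq_square algebra_simps)
    finally show ?thesis .
  qed
  have c0: "0 \<le> ?c" using assms(3) by (simp add: positive_operator_def)
  show ?thesis
  proof (cases "?c = 0")
    case True
    have "?b = 0"
    proof (rule ccontr)
      assume "?b \<noteq> 0"
      then show False using quad[of "- (?a + 1) / (2 * ?b)"] True by (simp add: field_simps)
    qed
    then show ?thesis using True by simp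
  next
    case False
    then have "0 < ?c" using c0 by simp
    then show ?thesis using quad[of "- ?b / ?c"]
      by (simp add: field_simps power2_eq_square)
  qed
qed

lemma weight_coercive:
  fixes \<beta> :: "'a :: complex_hilbert \<Rightarrow> 'a"
  assumes "weight \<beta>"
  shows "\<exists>c>0. \<forall>u. (norm u)\<^sup>2 / c \<le> Re (cinner (\<beta> u) u) \<and> Re (cinner (\<beta> u) u) \<le> c * (norm u)\<^sup>2"
proof -
  have lin: "Vector_Spaces.linear scaleC scaleC \<beta>" and sa: "selfadjoint \<beta>"
    and pos: "positive_operator \<beta>" and hom: "homeomorphism UNIV UNIV \<beta> (inv \<beta>)"
    using assms by (auto simp: weight_def)
  interpret l: Vector_Spaces.linear scaleC scaleC \<beta> by fact
  have iv: "inv \<beta> (\<beta> u) = u" "\<beta> (inv \<beta> u) = u" for u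
    using hom by (auto simp: homeomorphism_def)
  have rl: "linear \<beta>"
    by (rule linearI) (simp_all add: l.add l.scale flip: scaleC_of_real)
  have rli: "linear (inv \<beta>)"
  proof (intro linearI)
    fix u v r
    show "inv \<beta> (u + v) = inv \<beta> u + inv \<beta> v"
      using linear_add[OF rl, of "inv \<beta> u" "inv \<beta> v"] iv by metis
    show "inv \<beta> (r *\<^sub>R u) = r *\<^sub>R inv \<beta> u"
      using linear_scale[OF rl, of r "inv \<beta> u"] iv by metis
  qed
  have bdd: "bounded_linear g" if "linear g" "continuous_on UNIV g" for g :: "'a \<Rightarrow> 'a"
  proof -
    interpret g: linear g by fact
    have "\<forall>x\<in>UNIV. \<forall>e>0. \<exists>d>0. \<forall>x'\<in>UNIV. dist x' x < d \<longrightarrow> dist (g x') (g x) < e"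
      using that(2) by (simp add: continuous_on_iff)
    then obtain d where d: "d > 0" "\<And>v. norm v < d \<Longrightarrow> norm (g v) < 1"
      using g.zero by (metis UNIV_I dist_0_norm dist_commute zero_less_one)
    have "norm (g v) \<le> norm v * (2 / d)" for v
    proof (cases "v = 0")
      case False
      then have "norm (g ((d / (2 * norm v)) *\<^sub>R v)) < 1"
        using d(1) by (intro d(2)) simp
      then show ?thesis using False d(1) by (simp add: g.scale field_simps)
    qed (simp add: g.zero)
    then show ?thesis using bounded_linear_intro[of g "2 / d"] g.add g.scale by blast
  qed
  have cb: "continuous_on UNIV \<beta>" "continuous_on UNIV (inv \<beta>)"
    using hom by (auto simp: homeomorphism_def)
  obtain K where K: "K > 0" "\<And>u. norm (\<beta> u) \<le> norm u * K"
    using bounded_linear.pos_bounded[OF bdd[OF rl cb(1)]] by blast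
  obtain L where L: "L > 0" "\<And>u. norm (inv \<beta> u) \<le> norm u * L"
    using bounded_linear.pos_bounded[OF bdd[OF rli cb(2)]] by blast
  have id_w: "Vector_Spaces.linear scaleC scaleC (\<lambda>u::'a. u)" "selfadjoint (\<lambda>u::'a. u)"
    "positive_operator (\<lambda>u::'a. u)"
    using complex_hilbert.linear_ident
    by (auto simp: selfadjoint_def positive_operator_def cinner_ge_zero Im_cinner_self)
  have cs: "\<bar>Re (cinner u v)\<bar> \<le> norm u * norm v" for u v :: 'a
  proof -
    have "(Re (cinner u v))\<^sup>2 \<le> (norm u * norm v)\<^sup>2"
      using positive_cauchy_schwarz[OF id_w, of u v]
      by (simp add: Re_cinner_self power_mult_distrib)
    then show ?thesis by (simp add: abs_le_square_iff[symmetric] abs_mult)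
  qed
  have up: "Re (cinner (\<beta> u) u) \<le> K * (norm u)\<^sup>2" for u
  proof -
    have "Re (cinner (\<beta> u) u) \<le> norm (\<beta> u) * norm u" using cs[of "\<beta> u" u] by simp
    also have "\<dots> \<le> norm u * K * norm u" using K(2) by (intro mult_right_mono) auto
    finally show ?thesis by (simp add: power2_eq_square algebra_simps)
  qed
  have low: "(norm u)\<^sup>2 \<le> (L\<^sup>2 * K) * Re (cinner (\<beta> u) u)" for u
  proof -
    let ?q = "Re (cinner (\<beta> u) u)"
    have q0: "0 \<le> ?q" using pos by (simp add: positive_operator_def)
    have "((norm (\<beta> u))\<^sup>2)\<^sup>2 \<le> ?q * Re (cinner (\<beta> (\<beta> u)) (\<beta> u))"
      using positive_cauchy_schwarz[OF lin sa pos, of u "\<beta> u"] by (simp add: Re_cinner_self)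
    also have "\<dots> \<le> ?q * (K * (norm (\<beta> u))\<^sup>2)"
      using up q0 by (intro mult_left_mono) auto
    finally have sq: "(norm (\<beta> u))\<^sup>2 * (norm (\<beta> u))\<^sup>2 \<le> (?q * K) * (norm (\<beta> u))\<^sup>2"
      by (simp add: power2_eq_square algebra_simps)
    have "(norm (\<beta> u))\<^sup>2 \<le> ?q * K"
    proof (cases "norm (\<beta> u) = 0")
      case False
      then have "0 < (norm (\<beta> u))\<^sup>2" by simp
      with sq show ?thesis by (rule mult_right_le_imp_le)
    qed (use q0 K(1) in auto)
    moreover have "(norm u)\<^sup>2 \<le> (norm (\<beta> u) * L)\<^sup>2"
      using L(2)[of "\<beta> u"] by (intro power_mono) (auto simp: iv)
    ultimately have "(norm u)\<^sup>2 \<le> (?q * K) * L\<^sup>2"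
      using mult_right_mono[of "(norm (\<beta> u))\<^sup>2" "?q * K" "L\<^sup>2"]
      by (simp add: power_mult_distrib)
    then show ?thesis by (simp add: algebra_simps)
  qed
  define c where "c = max K (L\<^sup>2 * K)"
  have c: "0 < c" "K \<le> c" "L\<^sup>2 * K \<le> c" using K(1) by (auto simp: c_def)
  have "(norm u)\<^sup>2 / c \<le> Re (cinner (\<beta> u) u) \<and> Re (cinner (\<beta> u) u) \<le> c * (norm u)\<^sup>2" for u
  proof -
    have "0 \<le> Re (cinner (\<beta> u) u)" using pos by (simp add: positive_operator_def)
    then have "(norm u)\<^sup>2 \<le> c * Re (cinner (\<beta> u) u)"
      using low[of u] c(3) by (meson mult_right_mono order_trans)
    moreover have "Re (cinner (\<beta> u) u) \<le> c * (norm u)\<^sup>2"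
      using up[of u] c(2) by (meson mult_right_mono order_trans zero_le_power2)
    ultimately show ?thesis using c(1) by (simp add: field_simps)
  qed
  with c(1) show ?thesis by blast
qed

end

theory Submission
  imports Defs
begin

text \<open>Put \<open>e = x - x'\<close>, \<open>h = y - y'\<close>, \<open>\<gamma> = \<bar>\<omega>\<bar> \<alpha>1\<close> and \<open>z = \<langle>A e, h\<rangle> = \<langle>e, A\<^sup>* h\<rangle>\<close>. Since
  \<open>(x, y)\<close> solves the mixed problem, the two residuals in the majorant are
  \<open>A\<^sup>* h + \<i> \<omega> \<alpha>1 e\<close> and \<open>\<alpha>2 A e - h\<close>. Expanding their squares in the weighted norms gives
  (\<open>residual_identity\<close>)
  \<open>majorant = combined_norm\<^sup>2 - 2 (Re z + sgn \<omega> Im z)\<close>.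
  The two representations of \<open>z\<close> and the weighted Young inequality (\<open>weighted_young\<close>), applied
  with the weight \<open>\<alpha>2\<close> to the first and with \<open>\<gamma>\<close> to the second, bound \<open>4 \<bar>z\<bar>\<close> by
  \<open>combined_norm\<^sup>2\<close>. As \<open>\<bar>Re z + sgn \<omega> Im z\<bar> \<le> sqrt 2 \<bar>z\<bar>\<close>, the majorant differs
  from \<open>combined_norm\<^sup>2\<close> by at most \<open>combined_norm\<^sup>2 / sqrt 2\<close>, which is the first pair of
  estimates.

  For the normalized estimates the same identity is applied to \<open>(x, y)\<close> itself. There
  \<open>z = \<langle>A x, \<alpha>2 A x\<rangle>\<close> is real and nonnegative, which improves the comparison constants to
  \<open>\<bar>f\<bar>\<^sup>2 \<le> combined_norm\<^sup>2 \<le> 2 \<bar>f\<bar>\<^sup>2\<close>, where \<open>\<bar>f\<bar>\<close> is the norm weighted by the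
  inverse of \<open>\<gamma>\<close> (\<open>solution_norm_bounds\<close>).\<close>


section \<open>Inverses and multiples of weights\<close>

lemma cinner_zero_right: "cinner u (0 :: 'a :: complex_hilbert) = 0"
  using cinner_diff_right[of u 0 0] by simp

lemma cinner_minus_right: "cinner u (- v) = - cinner u (v :: 'a :: complex_hilbert)"
  using cinner_diff_right[of u 0 v] by (simp add: cinner_zero_right)

lemma weight_inv_cancel:
  assumes "weight \<beta>"
  shows "inv \<beta> (\<beta> u) = u" "\<beta> (inv \<beta> u) = u"
  using assms by (auto simp: weight_def homeomorphism_def)

lemma weight_inv:
  fixes \<beta> :: "'a :: complex_hilbert \<Rightarrow> 'a"
  assumes "weight \<beta>"
  shows "weight (inv \<beta>)"
proof -
  note iv = weight_inv_cancel[OF assms]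
  have hom: "homeomorphism UNIV UNIV \<beta> (inv \<beta>)"
    and sa: "\<And>u v. cinner (\<beta> u) v = cinner u (\<beta> v)"
    and pos: "\<And>u. Im (cinner (\<beta> u) u) = 0 \<and> 0 \<le> Re (cinner (\<beta> u) u)"
    using assms by (auto simp: weight_def selfadjoint_def positive_operator_def)
  interpret l: Vector_Spaces.linear scaleC scaleC \<beta>
    using assms by (simp add: weight_def)
  have "Vector_Spaces.linear scaleC scaleC (inv \<beta>)"
  proof
    fix u v c
    show "inv \<beta> (u + v) = inv \<beta> u + inv \<beta> v"
      using l.add[of "inv \<beta> u" "inv \<beta> v"] iv by metis
    show "inv \<beta> (c *\<^sub>C u) = c *\<^sub>C inv \<beta> u"
      using l.scale[of c "inv \<beta> u"] iv by metis
  qed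
  moreover have "selfadjoint (inv \<beta>)"
    unfolding selfadjoint_def using sa iv by metis
  moreover have "positive_operator (inv \<beta>)"
    unfolding positive_operator_def using sa pos iv by metis
  moreover have "inv (inv \<beta>) = \<beta>"
    by (rule inv_equality) (simp_all add: iv)
  ultimately show ?thesis
    using homeomorphism_symD[OF hom] by (simp add: weight_def)
qed

lemma weight_scaleR:
  fixes \<beta> :: "'a :: complex_hilbert \<Rightarrow> 'a"
  assumes "weight \<beta>" and "r > 0"
  shows "weight (\<lambda>u. r *\<^sub>R \<beta> u)"
proof -
  note iv = weight_inv_cancel[OF assms(1)]
  have hom: "homeomorphism UNIV UNIV \<beta> (inv \<beta>)"
    and sa: "\<And>u v. cinner (\<beta> u) v = cinner u (\<beta> v)"
    and pos: "\<And>u. Im (cinner (\<beta> u) u) = 0 \<and> 0 \<le> Re (cinner (\<beta> u) u)"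
    using assms(1) by (auto simp: weight_def selfadjoint_def positive_operator_def)
  interpret l: Vector_Spaces.linear scaleC scaleC \<beta>
    using assms(1) by (simp add: weight_def)
  have "Vector_Spaces.linear scaleC scaleC (\<lambda>u. r *\<^sub>R \<beta> u)"
    by unfold_locales
      (simp_all add: l.add l.scale scaleC_add_right scaleC_scaleC mult.commute
        flip: scaleC_of_real)
  moreover have "selfadjoint (\<lambda>u. r *\<^sub>R \<beta> u)"
    by (simp add: selfadjoint_def sa cinner_scaleC_left cinner_scaleC_right
        flip: scaleC_of_real)
  moreover have "positive_operator (\<lambda>u. r *\<^sub>R \<beta> u)"
    using pos assms(2)
    by (simp add: positive_operator_def cinner_scaleC_left flip: scaleC_of_real)
  moreover have "homeomorphism UNIV UNIV (\<lambda>u. r *\<^sub>R \<beta> u) (inv (\<lambda>u. r *\<^sub>R \<beta> u))"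
  proof -
    have rl: "inv \<beta> ((1 / r) *\<^sub>R r *\<^sub>R \<beta> u) = u" "r *\<^sub>R \<beta> (inv \<beta> ((1 / r) *\<^sub>R u)) = u" for u
      using assms(2) by (simp_all add: iv)
    have eq: "inv (\<lambda>u. r *\<^sub>R \<beta> u) = (\<lambda>v. inv \<beta> ((1 / r) *\<^sub>R v))"
      by (rule inv_equality) (use rl in auto)
    have cont: "continuous_on UNIV \<beta>" "continuous_on UNIV (inv \<beta>)"
      using hom by (auto simp: homeomorphism_def)
    show ?thesis
      unfolding eq
      by (rule homeomorphismI)
        (use rl in \<open>auto intro!: continuous_intros continuous_on_compose2[OF cont(2)] cont(1)\<close>)
  qed
  ultimately show ?thesis by (simp add: weight_def)
qed


section \<open>Weighted norms\<close>

lemma wnorm_sq: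
  assumes "weight \<beta>"
  shows "(wnorm \<beta> u)\<^sup>2 = Re (cinner (\<beta> u) u)"
  using assms by (simp add: wnorm_def weight_def positive_operator_def)

lemma wnorm_minus:
  fixes \<beta> :: "'a :: complex_hilbert \<Rightarrow> 'a"
  assumes "weight \<beta>"
  shows "wnorm \<beta> (- u) = wnorm \<beta> u"
proof -
  interpret l: Vector_Spaces.linear scaleC scaleC \<beta>
    using assms by (simp add: weight_def)
  have "cinner (\<beta> (- u)) (- u) = cinner (\<beta> u) u"
    using cinner_scaleC_left[of "- 1" "\<beta> u" u]
    by (simp add: l.neg cinner_minus_right scaleC_one)
  then show ?thesis by (simp add: wnorm_def)
qed

lemma wnorm_pos:
  fixes u :: "'a :: complex_hilbert"
  assumes "weight \<beta>" and "u \<noteq> 0"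
  shows "0 < (wnorm \<beta> u)\<^sup>2"
proof -
  obtain c where "c > 0" "(norm u)\<^sup>2 / c \<le> Re (cinner (\<beta> u) u)"
    using weight_coercive[OF assms(1)] by blast
  moreover have "0 < (norm u)\<^sup>2 / c"
    using \<open>c > 0\<close> assms(2) by simp
  ultimately show ?thesis by (simp add: wnorm_sq[OF assms(1)])
qed

text \<open>The cross term in the square of the norm of \<open>c \<beta> u + v\<close> for the inverse weight is free of the weight.
  Both the expansion of the residuals and the Young inequality come from this.\<close>

lemma wnorm_inv_expand:
  fixes u v :: "'a :: complex_hilbert"
  assumes "weight \<beta>"
  shows "(wnorm (inv \<beta>) (c *\<^sub>C \<beta> u + v))\<^sup>2 =
           (cmod c)\<^sup>2 * (wnorm \<beta> u)\<^sup>2 + (wnorm (inv \<beta>) v)\<^sup>2 + 2 * Re (c * cinner u v)"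
proof -
  note iv = weight_inv_cancel[OF assms]
  have w: "weight (inv \<beta>)" by (rule weight_inv[OF assms])
  interpret i: Vector_Spaces.linear scaleC scaleC "inv \<beta>"
    using w by (simp add: weight_def)
  have "cinner (inv \<beta> v) (\<beta> u) = cinner v u"
    using w iv by (simp add: weight_def selfadjoint_def)
  then have cross: "cinner (inv \<beta> v) (\<beta> u) = cnj (cinner u v)"
    by (simp add: cinner_commute[of v u])
  have self: "cinner u (\<beta> u) = cinner (\<beta> u) u"
    using assms by (simp add: weight_def selfadjoint_def)
  have im: "Im (cinner (\<beta> u) u) = 0"
    using assms by (simp add: weight_def positive_operator_def)
  have "cinner (inv \<beta> (c *\<^sub>C \<beta> u + v)) (c *\<^sub>C \<beta> u + v) =
      c * cnj c * cinner (\<beta> u) u + cinner (inv \<beta> v) v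
        + (c * cinner u v + cnj (c * cinner u v))"
    by (simp add: i.add i.scale iv cinner_add_left cinner_add_right cinner_scaleC_left
        cinner_scaleC_right cross self algebra_simps)
  then show ?thesis
    by (simp add: wnorm_sq[OF assms] wnorm_sq[OF w] complex_mult_cnj cmod_power2 im)
qed

lemma weighted_young:
  fixes u v :: "'a :: complex_hilbert"
  assumes "weight \<beta>"
  shows "2 * cmod (cinner u v) \<le> (wnorm \<beta> u)\<^sup>2 + (wnorm (inv \<beta>) v)\<^sup>2"
proof -
  \<comment> \<open>the unimodular factor that turns the inner product into minus its modulus\<close>
  define c where "c = (if cinner u v = 0 then 1 else - cnj (sgn (cinner u v)))"
  have "cmod c = 1" by (simp add: c_def norm_sgn)
  moreover have "c * cinner u v = - of_real (cmod (cinner u v))"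
    by (auto simp: c_def sgn_eq complex_norm_square[symmetric] power2_eq_square mult.commute
        mult.assoc)
  moreover have "0 \<le> (wnorm (inv \<beta>) (c *\<^sub>C \<beta> u + v))\<^sup>2" by simp
  ultimately show ?thesis
    unfolding wnorm_inv_expand[OF assms] by simp
qed


section \<open>The operator and its adjoint\<close>

lemma linear_operator_diff:
  assumes "linear_operator D A" and "u \<in> D" and "v \<in> D"
  shows "u - v \<in> D" "A (u - v) = A u - A v"
proof -
  show d: "u - v \<in> D"
    using assms by (auto simp: linear_operator_def intro: complex_hilbert.subspace_diff)
  have "A (u - v + v) = A (u - v) + A v"
    using assms d unfolding linear_operator_def by blast
  then show "A (u - v) = A u - A v" by simp
qed

lemma cinner_adj:
  assumes "densely_defined D" and "\<psi> \<in> adj_dom D A" and "\<phi> \<in> D"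
  shows "cinner (A \<phi>) \<psi> = cinner \<phi> (adj D A \<psi>)"
proof -
  obtain \<eta> where eta: "\<forall>\<phi>\<in>D. cinner (A \<phi>) \<psi> = cinner \<phi> \<eta>"
    using assms(2) by (auto simp: adj_dom_def)
  then show ?thesis
    using adj_eqI[where A = A, OF assms(1) eta] assms(3) by simp
qed

lemma adj_diff:
  assumes "densely_defined D" and "\<psi> \<in> adj_dom D A" and "\<theta> \<in> adj_dom D A"
  shows "\<psi> - \<theta> \<in> adj_dom D A" "adj D A (\<psi> - \<theta>) = adj D A \<psi> - adj D A \<theta>"
proof -
  have eq: "\<forall>\<phi>\<in>D. cinner (A \<phi>) (\<psi> - \<theta>) = cinner \<phi> (adj D A \<psi> - adj D A \<theta>)"
    using assms by (simp add: cinner_diff_right cinner_adj)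
  then show "\<psi> - \<theta> \<in> adj_dom D A" by (auto simp: adj_dom_def)
  show "adj D A (\<psi> - \<theta>) = adj D A \<psi> - adj D A \<theta>"
    by (rule adj_eqI[OF assms(1) eq])
qed


section \<open>Comparison of the residuals with the combined norm\<close>

lemma combined_norm_sq:
  "(combined_norm D A \<alpha>1 \<alpha>2 \<omega> \<phi> \<psi>)\<^sup>2 =
     (wnorm (\<lambda>u. \<bar>\<omega>\<bar> *\<^sub>R \<alpha>1 u) \<phi>)\<^sup>2 + (wnorm \<alpha>2 (A \<phi>))\<^sup>2 +
     (wnorm (inv \<alpha>2) \<psi>)\<^sup>2 + (wnorm (inv (\<lambda>u. \<bar>\<omega>\<bar> *\<^sub>R \<alpha>1 u)) (adj D A \<psi>))\<^sup>2"
  by (simp add: combined_norm_def)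

lemma first_residual_expand:
  fixes \<phi> \<eta> :: "'a :: complex_hilbert"
  assumes "weight \<alpha>1" and "\<omega> \<noteq> 0"
  shows "(wnorm (inv (\<lambda>u. \<bar>\<omega>\<bar> *\<^sub>R \<alpha>1 u)) (\<eta> + (\<i> * complex_of_real \<omega>) *\<^sub>C \<alpha>1 \<phi>))\<^sup>2 =
     (wnorm (\<lambda>u. \<bar>\<omega>\<bar> *\<^sub>R \<alpha>1 u) \<phi>)\<^sup>2 + (wnorm (inv (\<lambda>u. \<bar>\<omega>\<bar> *\<^sub>R \<alpha>1 u)) \<eta>)\<^sup>2
       - 2 * sgn \<omega> * Im (cinner \<phi> \<eta>)"
proof -
  have w: "weight (\<lambda>u. \<bar>\<omega>\<bar> *\<^sub>R \<alpha>1 u)"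
    using assms by (intro weight_scaleR) auto
  have "(\<i> * complex_of_real \<omega>) *\<^sub>C \<alpha>1 \<phi> =
      (\<i> * complex_of_real (sgn \<omega>)) *\<^sub>C (\<bar>\<omega>\<bar> *\<^sub>R \<alpha>1 \<phi>)"
    by (simp add: scaleC_scaleC mult.assoc sgn_mult_abs flip: scaleC_of_real of_real_mult)
  then show ?thesis
    using wnorm_inv_expand[OF w, of "\<i> * complex_of_real (sgn \<omega>)" \<phi> \<eta>] assms(2)
    by (simp add: norm_mult abs_sgn_eq add.commute)
qed

lemma second_residual_expand:
  fixes u \<psi> :: "'a :: complex_hilbert"
  assumes "weight \<beta>"
  shows "(wnorm (inv \<beta>) (\<beta> u - \<psi>))\<^sup>2 =
    (wnorm \<beta> u)\<^sup>2 + (wnorm (inv \<beta>) \<psi>)\<^sup>2 - 2 * Re (cinner u \<psi>)"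
  using wnorm_inv_expand[OF assms, of 1 u "- \<psi>"]
  by (simp add: scaleC_one cinner_minus_right wnorm_minus[OF weight_inv[OF assms]])

lemma residual_identity:
  fixes D :: "'a :: complex_hilbert set" and A :: "'a \<Rightarrow> 'b :: complex_hilbert"
  assumes "densely_defined D" and "weight \<alpha>1" and "weight \<alpha>2" and "\<omega> \<noteq> 0"
    and "\<phi> \<in> D" and "\<psi> \<in> adj_dom D A"
  shows "(wnorm (inv (\<lambda>u. \<bar>\<omega>\<bar> *\<^sub>R \<alpha>1 u))
            (adj D A \<psi> + (\<i> * complex_of_real \<omega>) *\<^sub>C \<alpha>1 \<phi>))\<^sup>2 +
         (wnorm (inv \<alpha>2) (\<alpha>2 (A \<phi>) - \<psi>))\<^sup>2 =
         (combined_norm D A \<alpha>1 \<alpha>2 \<omega> \<phi> \<psi>)\<^sup>2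
           - 2 * (Re (cinner (A \<phi>) \<psi>) + sgn \<omega> * Im (cinner (A \<phi>) \<psi>))"
  by (simp add: first_residual_expand[OF assms(2,4)] second_residual_expand[OF assms(3)]
      combined_norm_sq cinner_adj[OF assms(1,6,5)])

lemma cross_term_bound:
  fixes D :: "'a :: complex_hilbert set" and A :: "'a \<Rightarrow> 'b :: complex_hilbert"
  assumes "densely_defined D" and "weight \<alpha>1" and "weight \<alpha>2" and "\<omega> \<noteq> 0"
    and "\<phi> \<in> D" and "\<psi> \<in> adj_dom D A"
  shows "4 * cmod (cinner (A \<phi>) \<psi>) \<le> (combined_norm D A \<alpha>1 \<alpha>2 \<omega> \<phi> \<psi>)\<^sup>2"
proof -
  have w: "weight (\<lambda>u. \<bar>\<omega>\<bar> *\<^sub>R \<alpha>1 u)"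
    using assms(2,4) by (intro weight_scaleR) auto
  show ?thesis
    using weighted_young[OF assms(3), of "A \<phi>" \<psi>] weighted_young[OF w, of \<phi> "adj D A \<psi>"]
    by (simp add: combined_norm_sq cinner_adj[OF assms(1,6,5)])
qed

lemma abs_Re_add_sgn_Im_le: "\<bar>Re z + sgn r * Im z\<bar> \<le> sqrt 2 * cmod z"
proof -
  have "(Re z + sgn r * Im z)\<^sup>2 \<le> 2 * ((Re z)\<^sup>2 + (Im z)\<^sup>2)"
    using sum_squares_bound[of "Re z" "Im z"] sum_squares_bound[of "Re z" "- Im z"]
    by (auto simp: sgn_if power2_eq_square algebra_simps)
  also have "\<dots> = (sqrt 2 * cmod z)\<^sup>2"
    by (simp add: power_mult_distrib cmod_power2)
  finally show ?thesis
    by (simp add: abs_le_square_iff[symmetric] abs_mult)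
qed

lemma residual_bounds:
  fixes D :: "'a :: complex_hilbert set" and A :: "'a \<Rightarrow> 'b :: complex_hilbert"
  assumes "densely_defined D" and "weight \<alpha>1" and "weight \<alpha>2" and "\<omega> \<noteq> 0"
    and "\<phi> \<in> D" and "\<psi> \<in> adj_dom D A"
  defines "M \<equiv> (wnorm (inv (\<lambda>u. \<bar>\<omega>\<bar> *\<^sub>R \<alpha>1 u))
            (adj D A \<psi> + (\<i> * complex_of_real \<omega>) *\<^sub>C \<alpha>1 \<phi>))\<^sup>2 +
         (wnorm (inv \<alpha>2) (\<alpha>2 (A \<phi>) - \<psi>))\<^sup>2"
    and "N \<equiv> (combined_norm D A \<alpha>1 \<alpha>2 \<omega> \<phi> \<psi>)\<^sup>2"
  shows "sqrt 2 / (sqrt 2 + 1) * M \<le> N" "N \<le> sqrt 2 / (sqrt 2 - 1) * M"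
proof -
  let ?z = "cinner (A \<phi>) \<psi>"
  have M: "M = N - 2 * (Re ?z + sgn \<omega> * Im ?z)"
    unfolding M_def N_def by (rule residual_identity[OF assms(1-6)])
  have "4 * cmod ?z \<le> N"
    unfolding N_def by (rule cross_term_bound[OF assms(1-6)])
  then have z: "sqrt 2 * (4 * cmod ?z) \<le> sqrt 2 * N"
    by (intro mult_left_mono) auto
  have "2 * \<bar>N - M\<bar> = 4 * \<bar>Re ?z + sgn \<omega> * Im ?z\<bar>"
    unfolding M by (simp only: diff_diff_eq2 add_diff_cancel_left' abs_mult abs_numeral)
  also have "\<dots> \<le> 4 * (sqrt 2 * cmod ?z)"
    using abs_Re_add_sgn_Im_le[of ?z \<omega>] by (intro mult_left_mono) auto
  also have "\<dots> \<le> sqrt 2 * N"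
    using z by (simp only: mult.left_commute)
  finally have "2 * \<bar>N - M\<bar> \<le> sqrt 2 * N" .
  then have "sqrt 2 * (2 * \<bar>N - M\<bar>) \<le> sqrt 2 * (sqrt 2 * N)"
    by (intro mult_left_mono) auto
  moreover have "sqrt 2 * (2 * \<bar>N - M\<bar>) = 2 * (sqrt 2 * \<bar>N - M\<bar>)"
    by (rule mult.left_commute)
  moreover have "sqrt 2 * (sqrt 2 * N) = 2 * N"
    by (simp flip: mult.assoc)
  ultimately have d: "sqrt 2 * \<bar>N - M\<bar> \<le> N" by linarith
  have "sqrt 2 * (M - N) \<le> sqrt 2 * \<bar>N - M\<bar>" "sqrt 2 * (N - M) \<le> sqrt 2 * \<bar>N - M\<bar>"
    by (intro mult_left_mono; simp)+
  then have le: "sqrt 2 * M \<le> N * (sqrt 2 + 1)" "N * (sqrt 2 - 1) \<le> sqrt 2 * M"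
    using d by (simp_all add: algebra_simps)
  have pos: "0 < sqrt 2 + (1 :: real)" "0 < sqrt 2 - (1 :: real)"
    by (simp_all add: add_pos_pos)
  show "sqrt 2 / (sqrt 2 + 1) * M \<le> N"
    unfolding times_divide_eq_left pos_divide_le_eq[OF pos(1)] by (rule le(1))
  show "N \<le> sqrt 2 / (sqrt 2 - 1) * M"
    unfolding times_divide_eq_left pos_le_divide_eq[OF pos(2)] by (rule le(2))
qed

text \<open>For the solution the cross term equals \<open>\<langle>A x, \<alpha>2 A x\<rangle>\<close>: its imaginary part vanishes, so
  that the weighted square of \<open>f\<close> is the sum of the first and the last term of the squared
  combined norm, and its real part is the common value of the two middle terms.\<close>

lemma solution_norm_bounds:
  fixes D :: "'a :: complex_hilbert set" and A :: "'a \<Rightarrow> 'b :: complex_hilbert"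
  assumes "densely_defined D" and "weight \<alpha>1" and "weight \<alpha>2" and "\<omega> \<noteq> 0"
    and "mixed_solution D A \<alpha>1 \<alpha>2 \<omega> f x y"
  shows "(wnorm (inv (\<lambda>u. \<bar>\<omega>\<bar> *\<^sub>R \<alpha>1 u)) f)\<^sup>2 \<le> (combined_norm D A \<alpha>1 \<alpha>2 \<omega> x y)\<^sup>2"
    and "(combined_norm D A \<alpha>1 \<alpha>2 \<omega> x y)\<^sup>2 \<le> 2 * (wnorm (inv (\<lambda>u. \<bar>\<omega>\<bar> *\<^sub>R \<alpha>1 u)) f)\<^sup>2"
proof -
  let ?F = "(wnorm (inv (\<lambda>u. \<bar>\<omega>\<bar> *\<^sub>R \<alpha>1 u)) f)\<^sup>2"
  have x: "x \<in> D" and y: "y \<in> adj_dom D A" "y = \<alpha>2 (A x)"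
    and f: "f = adj D A y + (\<i> * complex_of_real \<omega>) *\<^sub>C \<alpha>1 x"
    using assms(5) by (auto simp: mixed_solution_def)
  have "cinner (A x) y = cinner (\<alpha>2 (A x)) (A x)"
    using assms(3) by (simp add: y(2) weight_def selfadjoint_def)
  then have z: "Im (cinner (A x) y) = 0" "0 \<le> Re (cinner (A x) y)"
    using assms(3) by (simp_all add: weight_def positive_operator_def)
  have w: "weight (\<lambda>u. \<bar>\<omega>\<bar> *\<^sub>R \<alpha>1 u)"
    using assms(2,4) by (intro weight_scaleR) auto
  have F: "?F = (wnorm (\<lambda>u. \<bar>\<omega>\<bar> *\<^sub>R \<alpha>1 u) x)\<^sup>2 +
      (wnorm (inv (\<lambda>u. \<bar>\<omega>\<bar> *\<^sub>R \<alpha>1 u)) (adj D A y))\<^sup>2"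
    using z(1) by (simp add: f first_residual_expand[OF assms(2,4)] cinner_adj[OF assms(1) y(1) x])
  have "(wnorm (inv \<alpha>2) (\<alpha>2 (A x) - y))\<^sup>2 = 0"
    by (simp add: y(2) wnorm_def cinner_zero_right)
  then have N: "(combined_norm D A \<alpha>1 \<alpha>2 \<omega> x y)\<^sup>2 = ?F + 2 * Re (cinner (A x) y)"
    using residual_identity[OF assms(1-4) x y(1)] z(1) by (simp add: f)
  show "?F \<le> (combined_norm D A \<alpha>1 \<alpha>2 \<omega> x y)\<^sup>2"
    using z(2) by (simp add: N)
  have "2 * Re (cinner (A x) y) \<le> 2 * cmod (cinner x (adj D A y))"
    using complex_Re_le_cmod[of "cinner (A x) y"] by (simp add: cinner_adj[OF assms(1) y(1) x])
  also have "\<dots> \<le> ?F"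
    using weighted_young[OF w, of x "adj D A y"] by (simp add: F)
  finally show "(combined_norm D A \<alpha>1 \<alpha>2 \<omega> x y)\<^sup>2 \<le> 2 * ?F"
    by (simp add: N)
qed


section \<open>The two-sided error estimates\<close>

theorem theorem2p13:
  fixes D :: "'a :: complex_hilbert set"
    and A :: "'a \<Rightarrow> 'b :: complex_hilbert"
    and \<alpha>1 :: "'a \<Rightarrow> 'a"
    and \<alpha>2 :: "'b \<Rightarrow> 'b"
    and \<omega> :: real
    and f x x' :: 'a
    and y y' :: 'b
  assumes "linear_operator D A" and "densely_defined D" and "closed_operator D A"
    and "weight \<alpha>1" and "weight \<alpha>2"
    and "\<omega> \<noteq> 0"
    and "mixed_solution D A \<alpha>1 \<alpha>2 \<omega> f x y"
    and "x' \<in> D" and "y' \<in> adj_dom D A"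
  shows "sqrt 2 / (sqrt 2 + 1) * mixed_majorant D A \<alpha>1 \<alpha>2 \<omega> f x' y'
           \<le> (combined_norm D A \<alpha>1 \<alpha>2 \<omega> (x - x') (y - y'))\<^sup>2 \<and>
         (combined_norm D A \<alpha>1 \<alpha>2 \<omega> (x - x') (y - y'))\<^sup>2
           \<le> sqrt 2 / (sqrt 2 - 1) * mixed_majorant D A \<alpha>1 \<alpha>2 \<omega> f x' y' \<and>
         (f \<noteq> 0 \<longrightarrow>
           sqrt 2 / (2 * (sqrt 2 + 1)) *
               (mixed_majorant D A \<alpha>1 \<alpha>2 \<omega> f x' y' / (wnorm (inv (\<lambda>u. \<bar>\<omega>\<bar> *\<^sub>R \<alpha>1 u)) f)\<^sup>2)
             \<le> (combined_norm D A \<alpha>1 \<alpha>2 \<omega> (x - x') (y - y'))\<^sup>2 / (combined_norm D A \<alpha>1 \<alpha>2 \<omega> x y)\<^sup>2 \<and>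
           (combined_norm D A \<alpha>1 \<alpha>2 \<omega> (x - x') (y - y'))\<^sup>2 / (combined_norm D A \<alpha>1 \<alpha>2 \<omega> x y)\<^sup>2
             \<le> sqrt 2 / (sqrt 2 - 1) *
               (mixed_majorant D A \<alpha>1 \<alpha>2 \<omega> f x' y' / (wnorm (inv (\<lambda>u. \<bar>\<omega>\<bar> *\<^sub>R \<alpha>1 u)) f)\<^sup>2))"
proof -
  let ?M = "mixed_majorant D A \<alpha>1 \<alpha>2 \<omega> f x' y'"
  let ?N = "(combined_norm D A \<alpha>1 \<alpha>2 \<omega> (x - x') (y - y'))\<^sup>2"
  let ?X = "(combined_norm D A \<alpha>1 \<alpha>2 \<omega> x y)\<^sup>2"
  let ?F = "(wnorm (inv (\<lambda>u. \<bar>\<omega>\<bar> *\<^sub>R \<alpha>1 u)) f)\<^sup>2"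
  have x: "x \<in> D" and y: "y \<in> adj_dom D A" "y = \<alpha>2 (A x)"
    and f: "f = adj D A y + (\<i> * complex_of_real \<omega>) *\<^sub>C \<alpha>1 x"
    using assms(7) by (auto simp: mixed_solution_def)
  interpret a1: Vector_Spaces.linear scaleC scaleC \<alpha>1
    using assms(4) by (simp add: weight_def)
  interpret a2: Vector_Spaces.linear scaleC scaleC \<alpha>2
    using assms(5) by (simp add: weight_def)
  note e = linear_operator_diff[OF assms(1) x assms(8)]
  note h = adj_diff[OF assms(2) y(1) assms(9)]
  have "f - (\<i> * complex_of_real \<omega>) *\<^sub>C \<alpha>1 x' - adj D A y' =
      adj D A (y - y') + (\<i> * complex_of_real \<omega>) *\<^sub>C \<alpha>1 (x - x')"
    by (simp add: f h a1.diff complex_hilbert.scale_right_diff_distrib)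
  moreover have "y' - \<alpha>2 (A x') = \<alpha>2 (A (x - x')) - (y - y')"
    by (simp add: y(2) e a2.diff)
  ultimately have M: "?M = (wnorm (inv (\<lambda>u. \<bar>\<omega>\<bar> *\<^sub>R \<alpha>1 u))
        (adj D A (y - y') + (\<i> * complex_of_real \<omega>) *\<^sub>C \<alpha>1 (x - x')))\<^sup>2 +
      (wnorm (inv \<alpha>2) (\<alpha>2 (A (x - x')) - (y - y')))\<^sup>2"
    by (simp only: mixed_majorant_def)
  note bounds = residual_bounds[OF assms(2,4,5,6) e(1) h(1), folded M]
  have "sqrt 2 / (2 * (sqrt 2 + 1)) * (?M / ?F) \<le> ?N / ?X \<and>
      ?N / ?X \<le> sqrt 2 / (sqrt 2 - 1) * (?M / ?F)" if "f \<noteq> 0"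
  proof
    have w: "weight (\<lambda>u. \<bar>\<omega>\<bar> *\<^sub>R \<alpha>1 u)"
      using assms(4,6) by (intro weight_scaleR) auto
    have F: "0 < ?F" by (rule wnorm_pos[OF weight_inv[OF w] that])
    note X = solution_norm_bounds[OF assms(2,4,5,6,7)]
    have "sqrt 2 / (2 * (sqrt 2 + 1)) * (?M / ?F) = (sqrt 2 / (sqrt 2 + 1) * ?M) / (2 * ?F)"
      by simp
    also have "\<dots> \<le> ?N / (2 * ?F)"
      using bounds(1) F by (intro divide_right_mono) auto
    also have "\<dots> \<le> ?N / ?X"
      using X F by (intro divide_left_mono mult_pos_pos) auto
    finally show "sqrt 2 / (2 * (sqrt 2 + 1)) * (?M / ?F) \<le> ?N / ?X" .
    have "?N / ?X \<le> ?N / ?F"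
      using X F by (intro divide_left_mono mult_pos_pos) auto
    also have "\<dots> \<le> (sqrt 2 / (sqrt 2 - 1) * ?M) / ?F"
      using bounds(2) F by (intro divide_right_mono) auto
    finally show "?N / ?X \<le> sqrt 2 / (sqrt 2 - 1) * (?M / ?F)" by simp
  qed
  with bounds show ?thesis by blast
qed

end
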